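(* For every finite set $\mathcal{P}$ of process identifiers, every guarded recursive specification $\Delta$ over TSP with sequencing and every $X\in\mathcal{P}$, there exists a pushdown automaton $M$ with at most two states (and input alphabet $\mathit{Act}$) whose process graph $\mathcal{P}(M)$ is bisimilar to the process graph of $X$.
   Context: Process graphs and bisimilarity: a process graph is a tuple $(\mathcal{S},\mathcal{A},\to,\uparrow,\downarrow)$ with states $\mathcal{S}$, actions $\mathcal{A}$ (silent action $\tau\notin\mathcal{A}$), transitions $\to\subseteq\mathcal{S}\times(\mathcal{A}\cup\{\tau\})\times\mathcal{S}$, root $\uparrow$, accepting states $\downarrow\subseteq\mathcal{S}$. A bisimulation between two process graphs is a symmetric relation $R$ on the disjoint union of their states such that whenever $s\,R\,t$: if $s\xrightarrow{a}s'$ then $t\xrightarrow{a}t'$ for some $t'$ with $s'\,R\,t'$; and if $s$ is accepting so is $t$. Graphs are bisimilar if a bisimulation relates their roots. Pushdown automaton: $M=(\mathcal{S},\mathcal{A},\mathcal{D},\to,\uparrow,\downarrow)$ with finite state set $\mathcal{S}$, finite input alphabet $\mathcal{A}$ ($\tau\notin\mathcal{A}$), finite data alphabet $\mathcal{D}$, finite set of transitions $\to\subseteq\mathcal{S}\times(\mathcal{A}\cup\{\tau\})\times(\mathcal{D}\cup\{\epsilon\})\times\mathcal{D}^*\times\mathcal{S}$ (written $s\xrightarrow{a[d/x]}t$), initial state $\uparrow$, final states $\downarrow\subseteq\mathcal{S}$. Its process graph $\mathcal{P}(M)$ has states $(s,x)$, $s\in\mathcal{S}$, $x\in\mathcal{D}^*$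 (leftmost symbol = top of stack); $(s,dx)\xrightarrow{a}(s',x'x)$ iff $s\xrightarrow{a[d/x']}s'$ ($d\in\mathcal{D}$); $(s,\epsilon)\xrightarrow{a}(s',x)$ iff $s\xrightarrow{a[\epsilon/x]}s'$; root $(\uparrow,\epsilon)$; accepting states all $(s,x)$ with $s\in\downarrow$. TSP with sequencing: fix a finite set of actions $\mathit{Act}$ ($\tau\notin\mathit{Act}$) and a finite set $\mathcal{P}$ of identifiers. Expressions: $p::=0\mid 1\mid a.p\mid p+p\mid p;p\mid X$ ($a\in\mathit{Act}\cup\{\tau\}$, $X\in\mathcal{P}$). A recursive specification $\Delta$ assigns an expression $\Delta(X)$ to each $X\in\mathcal{P}$; it is guarded if every identifier occurrence in each right-hand side lies within the scope of an action prefix. Operational semantics: $1\downarrow$; $a.p\xrightarrow{a}p$; $(p+q)\downarrow$ if $p\downarrow$ or $q\downarrow$; $p+q\xrightarrow{a}p'$ if $p\xrightarrow{a}p'$ or $q\xrightarrow{a}p'$; $(p;q)\downarrow$ if $p\downarrow$ and $q\downarrow$; $p;q\xrightarrow{a}p';q$ if $p\xrightarrow{a}p'$; $p;q\xrightarrow{a}q'$ if $p\downarrow$, $p$ has no outgoing transitions, and $q\xrightarrow{a}q'$; $X\xrightarrow{a}p'$ if $\Delta(X)\xrightarrow{a}p'$; $X\downarrow$ if $\Delta(X)\downarrow$ (for guarded $\Delta$ these rules determine a unique transition relation). The process graph of $p$ has all expressions as states, this transition relation and acceptance predicate, and root $p$. *)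

theory Defs
  imports Main
begin

section \<open>Process graphs and bisimilarity\<close>

datatype 'a action = Tau | Vis 'a

record ('s, 'a) pgraph =
  pg_states :: "'s set"
  pg_actions :: "'a set"
  pg_trans :: "('s \<times> 'a action \<times> 's) set"
  pg_root :: 's
  pg_accept :: "'s set"

definition process_graph :: "('s, 'a) pgraph \<Rightarrow> bool" where
  "process_graph G \<longleftrightarrow>
     pg_trans G \<subseteq> pg_states G \<times> insert Tau (Vis ` pg_actions G) \<times> pg_states G \<and>
     pg_root G \<in> pg_states G \<and> pg_accept G \<subseteq> pg_states G"

definition sum_trans ::
  "('s, 'a) pgraph \<Rightarrow> ('t, 'a) pgraph \<Rightarrow> (('s + 't) \<times> 'a action \<times> ('s + 't)) set" where
  "sum_trans G H =
     {(Inl s, a, Inl s') | s a s'. (s, a, s') \<in> pg_trans G} \<union>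
     {(Inr t, a, Inr t') | t a t'. (t, a, t') \<in> pg_trans H}"

definition bisimulation ::
  "('s, 'a) pgraph \<Rightarrow> ('t, 'a) pgraph \<Rightarrow> ('s + 't) rel \<Rightarrow> bool" where
  "bisimulation G H R \<longleftrightarrow>
     R \<subseteq> (pg_states G <+> pg_states H) \<times> (pg_states G <+> pg_states H) \<and>
     sym R \<and>
     (\<forall>s t. (s, t) \<in> R \<longrightarrow>
        (\<forall>a s'. (s, a, s') \<in> sum_trans G H \<longrightarrow>
           (\<exists>t'. (t, a, t') \<in> sum_trans G H \<and> (s', t') \<in> R)) \<and>
        (s \<in> pg_accept G <+> pg_accept H \<longrightarrow> t \<in> pg_accept G <+> pg_accept H))"

definition bisimilar :: "('s, 'a) pgraph \<Rightarrow> ('t, 'a) pgraph \<Rightarrow> bool" where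
  "bisimilar G H \<longleftrightarrow> (\<exists>R. bisimulation G H R \<and> (Inl (pg_root G), Inr (pg_root H)) \<in> R)"


section \<open>Pushdown automata\<close>

text \<open>In a transition \<open>(s, a, d, x, t)\<close> the value \<open>d = None\<close> stands for the empty stack,
  \<open>d = Some e\<close> for top symbol \<open>e\<close>. The head of a list is the top of the stack.\<close>

record ('s, 'a, 'd) pda =
  pda_states :: "'s set"
  pda_inputs :: "'a set"
  pda_data :: "'d set"
  pda_trans :: "('s \<times> 'a action \<times> 'd option \<times> 'd list \<times> 's) set"
  pda_init :: 's
  pda_final :: "'s set"

definition pushdown_automaton :: "('s, 'a, 'd) pda \<Rightarrow> bool" where
  "pushdown_automaton M \<longleftrightarrow>
     finite (pda_states M) \<and> finite (pda_inputs M) \<and> finite (pda_data M) \<and>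
     finite (pda_trans M) \<and>
     pda_trans M \<subseteq> pda_states M \<times> insert Tau (Vis ` pda_inputs M) \<times>
       insert None (Some ` pda_data M) \<times> lists (pda_data M) \<times> pda_states M \<and>
     pda_init M \<in> pda_states M \<and> pda_final M \<subseteq> pda_states M"

definition pda_graph :: "('s, 'a, 'd) pda \<Rightarrow> ('s \<times> 'd list, 'a) pgraph" where
  "pda_graph M =
     \<lparr>pg_states = pda_states M \<times> lists (pda_data M),
      pg_actions = pda_inputs M,
      pg_trans =
        {((s, d # x), a, (s', x' @ x)) | s d x a s' x'.
           (s, a, Some d, x', s') \<in> pda_trans M \<and> x \<in> lists (pda_data M)} \<union>
        {((s, []), a, (s', x)) | s a s' x. (s, a, None, x, s') \<in> pda_trans M},
      pg_root = (pda_init M, []),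
      pg_accept = pda_final M \<times> lists (pda_data M)\<rparr>"

lemma process_graph_pda_graph:
  assumes "pushdown_automaton M"
  shows "process_graph (pda_graph M)"
proof -
  have tr: "s \<in> pda_states M \<and> a \<in> insert Tau (Vis ` pda_inputs M) \<and>
      d \<in> insert None (Some ` pda_data M) \<and> x \<in> lists (pda_data M) \<and> s' \<in> pda_states M"
    if "(s, a, d, x, s') \<in> pda_trans M" for s a d x s'
    using assms that unfolding pushdown_automaton_def by blast
  show ?thesis
    using assms unfolding pushdown_automaton_def process_graph_def pda_graph_def
    by (auto dest!: tr)
qed


section \<open>TSP with sequencing\<close>

datatype (expr_acts: 'a, expr_idents: 'x) expr =
    Zero
  | One
  | Prefix "'a action" "('a, 'x) expr"
  | Alt "('a, 'x) expr" "('a, 'x) expr"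
  | Seq "('a, 'x) expr" "('a, 'x) expr"
  | Ident 'x

definition exprs :: "'a set \<Rightarrow> 'x set \<Rightarrow> ('a, 'x) expr set" where
  "exprs Act P = {p. expr_acts p \<subseteq> Act \<and> expr_idents p \<subseteq> P}"

definition rec_spec :: "'a set \<Rightarrow> 'x set \<Rightarrow> ('x \<rightharpoonup> ('a, 'x) expr) \<Rightarrow> bool" where
  "rec_spec Act P \<Delta> \<longleftrightarrow> dom \<Delta> = P \<and> ran \<Delta> \<subseteq> exprs Act P"

primrec guarded_expr :: "('a, 'x) expr \<Rightarrow> bool" where
  "guarded_expr Zero \<longleftrightarrow> True"
| "guarded_expr One \<longleftrightarrow> True"
| "guarded_expr (Prefix a p) \<longleftrightarrow> True"
| "guarded_expr (Alt p q) \<longleftrightarrow> guarded_expr p \<and> guarded_expr q"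
| "guarded_expr (Seq p q) \<longleftrightarrow> guarded_expr p \<and> guarded_expr q"
| "guarded_expr (Ident X) \<longleftrightarrow> False"

definition guarded_spec :: "('x \<rightharpoonup> ('a, 'x) expr) \<Rightarrow> bool" where
  "guarded_spec \<Delta> \<longleftrightarrow> (\<forall>p \<in> ran \<Delta>. guarded_expr p)"

inductive accepts :: "('x \<rightharpoonup> ('a, 'x) expr) \<Rightarrow> ('a, 'x) expr \<Rightarrow> bool"
  for \<Delta> :: "'x \<rightharpoonup> ('a, 'x) expr" where
  acc_One: "accepts \<Delta> One"
| acc_Alt1: "accepts \<Delta> p \<Longrightarrow> accepts \<Delta> (Alt p q)"
| acc_Alt2: "accepts \<Delta> q \<Longrightarrow> accepts \<Delta> (Alt p q)"
| acc_Seq: "accepts \<Delta> p \<Longrightarrow> accepts \<Delta> q \<Longrightarrow> accepts \<Delta> (Seq p q)"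
| acc_Ident: "\<Delta> X = Some p \<Longrightarrow> accepts \<Delta> p \<Longrightarrow> accepts \<Delta> (Ident X)"

text \<open>The second rule for \<open>Seq\<close> has a negative premise, so the rules do not form a monotone
  inductive definition. We first read the negative premise off a parameter \<open>N\<close>
  (``has no outgoing transitions'') and then require \<open>N\<close> to be the set of expressions
  without outgoing transitions in the relation so defined, i.e. we take the stable transition
  relation of the rules. Lemma \<open>ex1_stable_trans\<close> shows that it exists and is unique for
  guarded specifications; otherwise \<open>tsp_step\<close> carries no meaning.\<close>

inductive step_wrt ::
  "('x \<rightharpoonup> ('a, 'x) expr) \<Rightarrow> (('a, 'x) expr \<Rightarrow> bool) \<Rightarrow>
   ('a, 'x) expr \<Rightarrow> 'a action \<Rightarrow> ('a, 'x) expr \<Rightarrow> bool"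
  for \<Delta> :: "'x \<rightharpoonup> ('a, 'x) expr" and N :: "('a, 'x) expr \<Rightarrow> bool" where
  step_Prefix: "step_wrt \<Delta> N (Prefix a p) a p"
| step_Alt1: "step_wrt \<Delta> N p a p' \<Longrightarrow> step_wrt \<Delta> N (Alt p q) a p'"
| step_Alt2: "step_wrt \<Delta> N q a q' \<Longrightarrow> step_wrt \<Delta> N (Alt p q) a q'"
| step_Seq1: "step_wrt \<Delta> N p a p' \<Longrightarrow> step_wrt \<Delta> N (Seq p q) a (Seq p' q)"
| step_Seq2: "accepts \<Delta> p \<Longrightarrow> N p \<Longrightarrow> step_wrt \<Delta> N q a q' \<Longrightarrow> step_wrt \<Delta> N (Seq p q) a q'"
| step_Ident: "\<Delta> X = Some p \<Longrightarrow> step_wrt \<Delta> N p a p' \<Longrightarrow> step_wrt \<Delta> N (Ident X) a p'"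

definition stable_trans ::
  "('x \<rightharpoonup> ('a, 'x) expr) \<Rightarrow> (('a, 'x) expr \<Rightarrow> 'a action \<Rightarrow> ('a, 'x) expr \<Rightarrow> bool) \<Rightarrow> bool" where
  "stable_trans \<Delta> T \<longleftrightarrow> T = step_wrt \<Delta> (\<lambda>p. \<nexists>a p'. T p a p')"

definition tsp_step ::
  "('x \<rightharpoonup> ('a, 'x) expr) \<Rightarrow> ('a, 'x) expr \<Rightarrow> 'a action \<Rightarrow> ('a, 'x) expr \<Rightarrow> bool" where
  "tsp_step \<Delta> = (THE T. stable_trans \<Delta> T)"

definition tsp_graph ::
  "'a set \<Rightarrow> 'x set \<Rightarrow> ('x \<rightharpoonup> ('a, 'x) expr) \<Rightarrow> ('a, 'x) expr \<Rightarrow> (('a, 'x) expr, 'a) pgraph" where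
  "tsp_graph Act P \<Delta> p =
     \<lparr>pg_states = exprs Act P,
      pg_actions = Act,
      pg_trans = {(q, a, q'). q \<in> exprs Act P \<and> tsp_step \<Delta> q a q'},
      pg_root = p,
      pg_accept = {q \<in> exprs Act P. accepts \<Delta> q}\<rparr>"


subsection \<open>Well-definedness of the transition relation\<close>

inductive_simps step_wrt_simps:
  "step_wrt \<Delta> N Zero a r"
  "step_wrt \<Delta> N One a r"
  "step_wrt \<Delta> N (Prefix b p) a r"
  "step_wrt \<Delta> N (Alt p q) a r"
  "step_wrt \<Delta> N (Seq p q) a r"
  "step_wrt \<Delta> N (Ident X) a r"

primrec guarded_steps ::
  "('x \<rightharpoonup> ('a, 'x) expr) \<Rightarrow> ('a action \<Rightarrow> 'x \<Rightarrow> ('a, 'x) expr set) \<Rightarrow>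
   ('a, 'x) expr \<Rightarrow> 'a action \<Rightarrow> ('a, 'x) expr set" where
  "guarded_steps \<Delta> I Zero = (\<lambda>a. {})"
| "guarded_steps \<Delta> I One = (\<lambda>a. {})"
| "guarded_steps \<Delta> I (Prefix b p) = (\<lambda>a. if a = b then {p} else {})"
| "guarded_steps \<Delta> I (Alt p q) = (\<lambda>a. guarded_steps \<Delta> I p a \<union> guarded_steps \<Delta> I q a)"
| "guarded_steps \<Delta> I (Seq p q) = (\<lambda>a. (\<lambda>p'. Seq p' q) ` guarded_steps \<Delta> I p a \<union>
     (if accepts \<Delta> p \<and> (\<forall>b. guarded_steps \<Delta> I p b = {}) then guarded_steps \<Delta> I q a else {}))"
| "guarded_steps \<Delta> I (Ident X) = (\<lambda>a. I a X)"

lemma guarded_steps_indep: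
  "guarded_expr p \<Longrightarrow> guarded_steps \<Delta> I p = guarded_steps \<Delta> J p"
  by (induction p) (simp_all cong: if_cong)

lemma ex_stable_trans:
  assumes "guarded_spec \<Delta>"
  shows "\<exists>T. stable_trans \<Delta> T"
proof -
  define I where
    "I = (\<lambda>a X. case \<Delta> X of None \<Rightarrow> {} | Some p \<Rightarrow> guarded_steps \<Delta> (\<lambda>_ _. {}) p a)"
  define T where "T = (\<lambda>p a p'. p' \<in> guarded_steps \<Delta> I p a)"
  let ?N = "\<lambda>p. \<nexists>a p'. T p a p'"
  have N: "?N p \<longleftrightarrow> (\<forall>b. guarded_steps \<Delta> I p b = {})" for p
    unfolding T_def by blast
  have gexp: "guarded_expr p" if "\<Delta> X = Some p" for X p
    using assms that unfolding guarded_spec_def by (auto intro: ranI)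
  have I: "I a X = guarded_steps \<Delta> I p a" if "\<Delta> X = Some p" for X p a
    using guarded_steps_indep[OF gexp[OF that], of \<Delta> "\<lambda>_ _. {}" I] that by (simp add: I_def)
  have g: "guarded_expr p \<Longrightarrow> step_wrt \<Delta> ?N p a p' \<longleftrightarrow> T p a p'" for p a p'
    by (induction p arbitrary: a p')
      (simp_all only: step_wrt_simps guarded_expr.simps N, auto simp: T_def)
  have "step_wrt \<Delta> ?N p a p' \<longleftrightarrow> T p a p'" for p a p'
  proof (induction p arbitrary: a p')
    case (Ident X)
    show ?case
    proof (cases "\<Delta> X")
      case None
      then show ?thesis by (simp add: step_wrt_simps T_def I_def)
    next
      case (Some p)
      have "step_wrt \<Delta> ?N (Ident X) a p' \<longleftrightarrow> step_wrt \<Delta> ?N p a p'"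
        using Some by (simp add: step_wrt_simps)
      also have "\<dots> \<longleftrightarrow> T p a p'" by (rule g[OF gexp[OF Some]])
      also have "\<dots> \<longleftrightarrow> T (Ident X) a p'" by (simp add: T_def I[OF Some])
      finally show ?thesis .
    qed
  qed (simp_all only: step_wrt_simps N, auto simp: T_def)
  then have "stable_trans \<Delta> T" unfolding stable_trans_def by blast
  then show ?thesis by blast
qed

lemma stable_trans_simps:
  assumes "stable_trans \<Delta> T"
  shows "T Zero a r \<longleftrightarrow> False"
    and "T One a r \<longleftrightarrow> False"
    and "T (Prefix b p) a r \<longleftrightarrow> b = a \<and> p = r"
    and "T (Alt p q) a r \<longleftrightarrow> T p a r \<or> T q a r"
    and "T (Seq p q) a r \<longleftrightarrow> (\<exists>p'. r = Seq p' q \<and> T p a p') \<or>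
      accepts \<Delta> p \<and> (\<nexists>b p'. T p b p') \<and> T q a r"
    and "T (Ident X) a r \<longleftrightarrow> (\<exists>p. \<Delta> X = Some p \<and> T p a r)"
proof -
  define N where "N = (\<lambda>p. \<nexists>a p'. T p a p')"
  have T: "T = step_wrt \<Delta> N" using assms unfolding stable_trans_def N_def .
  have "T (Seq p q) a r \<longleftrightarrow> (\<exists>p'. r = Seq p' q \<and> T p a p') \<or> accepts \<Delta> p \<and> N p \<and> T q a r"
    unfolding T by (auto simp: step_wrt_simps)
  then show "T (Seq p q) a r \<longleftrightarrow> (\<exists>p'. r = Seq p' q \<and> T p a p') \<or>
      accepts \<Delta> p \<and> (\<nexists>b p'. T p b p') \<and> T q a r"
    unfolding N_def .
  show "T Zero a r \<longleftrightarrow> False" "T One a r \<longleftrightarrow> False"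
    "T (Prefix b p) a r \<longleftrightarrow> b = a \<and> p = r" "T (Alt p q) a r \<longleftrightarrow> T p a r \<or> T q a r"
    "T (Ident X) a r \<longleftrightarrow> (\<exists>p. \<Delta> X = Some p \<and> T p a r)"
    unfolding T by (auto simp: step_wrt_simps)
qed

lemma stable_trans_unique:
  assumes "guarded_spec \<Delta>" "stable_trans \<Delta> T" "stable_trans \<Delta> U"
  shows "T = U"
proof -
  note T_simps = stable_trans_simps[OF assms(2)]
  note U_simps = stable_trans_simps[OF assms(3)]
  have g: "guarded_expr p \<Longrightarrow> T p a r \<longleftrightarrow> U p a r" for p a r
    by (induction p arbitrary: a r) (simp_all add: T_simps U_simps)
  have gexp: "guarded_expr p" if "\<Delta> X = Some p" for X p
    using assms(1) that unfolding guarded_spec_def by (auto intro: ranI)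
  have "T p a r \<longleftrightarrow> U p a r" for p a r
  proof (induction p arbitrary: a r)
    case (Ident X)
    then show ?case using g gexp by (auto simp: T_simps(6) U_simps(6))
  qed (simp_all add: T_simps(1-5) U_simps(1-5))
  then show ?thesis by blast
qed

lemma ex1_stable_trans:
  assumes "guarded_spec \<Delta>"
  shows "\<exists>!T. stable_trans \<Delta> T"
  using ex_stable_trans[OF assms] stable_trans_unique[OF assms] by blast

lemma tsp_step_stable:
  assumes "guarded_spec \<Delta>"
  shows "tsp_step \<Delta> = step_wrt \<Delta> (\<lambda>p. \<nexists>a p'. tsp_step \<Delta> p a p')"
  using theI'[OF ex1_stable_trans[OF assms]] unfolding tsp_step_def stable_trans_def .

lemmas tsp_step_simps = stable_trans_simps[OF tsp_step_stable[folded stable_trans_def]]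

lemma step_wrt_closed:
  assumes "step_wrt \<Delta> N p a p'" "rec_spec Act P \<Delta>" "p \<in> exprs Act P"
  shows "a \<in> insert Tau (Vis ` Act) \<and> p' \<in> exprs Act P"
  using assms
proof (induction rule: step_wrt.induct)
  case (step_Prefix a p)
  then show ?case by (cases a) (auto simp: exprs_def)
next
  case (step_Ident X p a p')
  then have "p \<in> exprs Act P" by (auto simp: rec_spec_def intro: ranI)
  with step_Ident show ?case by blast
qed (auto simp: exprs_def)

lemma process_graph_tsp_graph:
  assumes "rec_spec Act P \<Delta>" "guarded_spec \<Delta>" "p \<in> exprs Act P"
  shows "process_graph (tsp_graph Act P \<Delta> p)"
proof -
  have "a \<in> insert Tau (Vis ` Act) \<and> q' \<in> exprs Act P"
    if "q \<in> exprs Act P" "tsp_step \<Delta> q a q'" for q a q'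
  proof -
    have "step_wrt \<Delta> (\<lambda>p. \<nexists>a p'. tsp_step \<Delta> p a p') q a q'"
      using that(2) tsp_step_stable[OF assms(2)] by metis
    from step_wrt_closed[OF this assms(1) that(1)] show ?thesis .
  qed
  then show ?thesis using assms(3) unfolding process_graph_def tsp_graph_def by auto
qed

end

theory Submission
  imports Defs
begin

text \<open>Call an expression transparent if it accepts and has no transitions. Splitting at sequencing
  and discarding transparent factors turns an expression into a list of factors; only the first
  factor of that list can move, and the expression accepts iff all factors do. Along a run every
  factor is a subexpression of some right-hand side, so finitely many stack symbols suffice.
  Acceptance depends on the whole stack, but it can be kept in a control state with two values:
  each stack symbol also records whether everything below it accepts, so the acceptance status
  is known again after each pop. A dead symbol \<open>One\<close> stays at the bottom, so that the empty
  stack occurs only at the root.\<close>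

section \<open>Factorisation of expressions and the two-state automaton\<close>

definition transparent :: "('x \<rightharpoonup> ('a, 'x) expr) \<Rightarrow> ('a, 'x) expr \<Rightarrow> bool" where
  "transparent \<Delta> p \<longleftrightarrow> accepts \<Delta> p \<and> (\<nexists>a p'. tsp_step \<Delta> p a p')"

text \<open>Only \<open>Seq\<close> is split. A sum stays a single factor even if its summands are
  sequences, because its first step resolves the choice and only then exposes a sequence to
  split.\<close>

fun factors :: "('x \<rightharpoonup> ('a, 'x) expr) \<Rightarrow> ('a, 'x) expr \<Rightarrow> ('a, 'x) expr list" where
  "factors \<Delta> (Seq p q) = factors \<Delta> p @ factors \<Delta> q"
| "factors \<Delta> p = (if transparent \<Delta> p then [] else [p])"

primrec subexprs :: "('a, 'x) expr \<Rightarrow> ('a, 'x) expr set" where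
  "subexprs Zero = {Zero}"
| "subexprs One = {One}"
| "subexprs (Prefix a p) = insert (Prefix a p) (subexprs p)"
| "subexprs (Alt p q) = insert (Alt p q) (subexprs p \<union> subexprs q)"
| "subexprs (Seq p q) = insert (Seq p q) (subexprs p \<union> subexprs q)"
| "subexprs (Ident X) = {Ident X}"

text \<open>\<open>One\<close> is added for the bottom marker. The root \<open>Ident X\<close> may
  be absent, as \<open>X\<close> need not occur in any right-hand side; the root is therefore
  treated separately throughout.\<close>

definition spec_exprs :: "('x \<rightharpoonup> ('a, 'x) expr) \<Rightarrow> ('a, 'x) expr set" where
  "spec_exprs \<Delta> = insert One (\<Union>p\<in>ran \<Delta>. subexprs p)"

text \<open>The argument \<open>b\<close> is the acceptance status of whatever lies below the list,
  so a segment can be annotated without inspecting the stack it is pushed onto. The flag of an entry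
  concerns only what is below it, not the entry itself.\<close>

primrec annotate ::
  "('x \<rightharpoonup> ('a, 'x) expr) \<Rightarrow> bool \<Rightarrow> ('a, 'x) expr list \<Rightarrow> (('a, 'x) expr \<times> bool) list" where
  "annotate \<Delta> b [] = []"
| "annotate \<Delta> b (p # ps) = (p, b \<and> list_all (accepts \<Delta>) ps) # annotate \<Delta> b ps"

text \<open>The map \<open>f\<close> codes stack symbols as numbers. Control state 1 stands for
  acceptance. A move on a symbol \<open>(p, b)\<close> ignores the old control state and computes
  the new one from \<open>b\<close> and \<open>p'\<close>; if nothing is pushed, \<open>p'\<close>
  is transparent, hence accepting, and the new status is \<open>b\<close>. As \<open>One\<close>
  accepts, the marker does not affect any flag.\<close>

definition seq_pda ::
  "'a set \<Rightarrow> ('x \<rightharpoonup> ('a, 'x) expr) \<Rightarrow> (('a, 'x) expr \<times> bool \<Rightarrow> nat) \<Rightarrow> 'x \<Rightarrow> (nat, 'a, nat) pda"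
  where
  "seq_pda Act \<Delta> f X =
     \<lparr>pda_states = {0, 1},
      pda_inputs = Act,
      pda_data = f ` (spec_exprs \<Delta> \<times> UNIV),
      pda_trans =
        {(s, a, Some (f (p, b)), map f (annotate \<Delta> b (factors \<Delta> p')), of_bool (b \<and> accepts \<Delta> p'))
          | s a p b p'. s \<in> {0, 1} \<and> p \<in> spec_exprs \<Delta> \<and> tsp_step \<Delta> p a p'} \<union>
        {(of_bool (accepts \<Delta> (Ident X)), a, None, map f (annotate \<Delta> True (factors \<Delta> p' @ [One])),
            of_bool (accepts \<Delta> p')) | a p'. tsp_step \<Delta> (Ident X) a p'},
      pda_init = of_bool (accepts \<Delta> (Ident X)),
      pda_final = {1}\<rparr>"

\<comment> \<open>Bisimilarity, subexpressions and annotated lists\<close>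
inductive_simps accepts_Seq [simp]: "accepts \<Delta> (Seq p q)"

text \<open>The symmetric closure of \<open>R\<close> inside the disjoint sum is a bisimulation;
  this lets later arguments work with pairs of states and without injections.\<close>

lemma bisimilarI:
  assumes root: "(pg_root G, pg_root H) \<in> R"
    and states: "R \<subseteq> pg_states G \<times> pg_states H"
    and accept: "\<And>s t. (s, t) \<in> R \<Longrightarrow> s \<in> pg_accept G \<longleftrightarrow> t \<in> pg_accept H"
    and forward: "\<And>s t a s'. (s, t) \<in> R \<Longrightarrow> (s, a, s') \<in> pg_trans G \<Longrightarrow>
      \<exists>t'. (t, a, t') \<in> pg_trans H \<and> (s', t') \<in> R"
    and backward: "\<And>s t a t'. (s, t) \<in> R \<Longrightarrow> (t, a, t') \<in> pg_trans H \<Longrightarrow>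
      \<exists>s'. (s, a, s') \<in> pg_trans G \<and> (s', t') \<in> R"
  shows "bisimilar G H"
proof -
  let ?Q = "{(Inl s, Inr t) | s t. (s, t) \<in> R} \<union> {(Inr t, Inl s) | s t. (s, t) \<in> R}"
  have "bisimulation G H ?Q"
    unfolding bisimulation_def
  proof (intro conjI allI impI)
    show "?Q \<subseteq> (pg_states G <+> pg_states H) \<times> (pg_states G <+> pg_states H)"
      using states by auto
    show "sym ?Q" by (auto simp: sym_def)
  next
    fix x y a x' assume "(x, y) \<in> ?Q" "(x, a, x') \<in> sum_trans G H"
    then consider s t s' where "x = Inl s" "y = Inr t" "x' = Inl s'" "(s, t) \<in> R"
        "(s, a, s') \<in> pg_trans G"
      | s t t' where "x = Inr t" "y = Inl s" "x' = Inr t'" "(s, t) \<in> R" "(t, a, t') \<in> pg_trans H"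
      unfolding sum_trans_def by blast
    then show "\<exists>y'. (y, a, y') \<in> sum_trans G H \<and> (x', y') \<in> ?Q"
    proof cases
      case 1
      then show ?thesis using forward[OF 1(4,5)] unfolding sum_trans_def by blast
    next
      case 2
      then show ?thesis using backward[OF 2(4,5)] unfolding sum_trans_def by blast
    qed
  next
    fix x y assume "(x, y) \<in> ?Q" "x \<in> pg_accept G <+> pg_accept H"
    then show "y \<in> pg_accept G <+> pg_accept H" using accept by auto
  qed
  with root show ?thesis unfolding bisimilar_def by blast
qed

lemma finite_subexprs [simp]: "finite (subexprs p)"
  by (induction p) auto

lemma self_in_subexprs [simp]: "p \<in> subexprs p"
  by (cases p) auto

lemma subexprs_trans: "q \<in> subexprs p \<Longrightarrow> subexprs q \<subseteq> subexprs p"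
  by (induction p) auto

lemma subexprs_subset_spec_exprs:
  assumes "p \<in> spec_exprs \<Delta>"
  shows "subexprs p \<subseteq> spec_exprs \<Delta>"
  using assms unfolding spec_exprs_def by (auto dest: subexprs_trans)

lemma factors_subset_subexprs: "set (factors \<Delta> p) \<subseteq> subexprs p"
  by (induction p) auto

text \<open>Discarded factors are transparent and so accept; dropping them does not change the
  conjunction.\<close>

lemma list_all_accepts_factors: "list_all (accepts \<Delta>) (factors \<Delta> p) \<longleftrightarrow> accepts \<Delta> p"
  by (induction p) (auto simp: transparent_def)

text \<open>Replacing the top of the stack is a local operation: the upper segment needs one bit
  about the lower one, and the flags already on the stack stay correct.\<close>

lemma annotate_append:
  "annotate \<Delta> b (xs @ ys) = annotate \<Delta> (b \<and> list_all (accepts \<Delta>) ys) xs @ annotate \<Delta> b ys"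
  by (induction xs) auto

lemma map_annotate_in_lists:
  "set ps \<subseteq> A \<Longrightarrow> map f (annotate \<Delta> b ps) \<in> lists (f ` (A \<times> UNIV))"
  by (induction ps) auto

section \<open>Transitions in terms of factors\<close>

context
  fixes \<Delta> :: "'x \<rightharpoonup> ('a, 'x) expr"
  assumes guarded: "guarded_spec \<Delta>"
begin

lemmas step_simps = tsp_step_simps[OF guarded]

text \<open>The point is that transparency is a conjunction over \<open>Seq\<close>: a step of
  \<open>p\<close> is a step of \<open>Seq p q\<close>, and once \<open>p\<close> is transparent,
  \<open>Seq p q\<close> has exactly the steps of \<open>q\<close>.\<close>

lemma factors_Nil_iff: "factors \<Delta> p = [] \<longleftrightarrow> transparent \<Delta> p"
proof (induction p)
  case (Seq p q)
  have "transparent \<Delta> (Seq p q) \<longleftrightarrow> transparent \<Delta> p \<and> transparent \<Delta> q"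
    unfolding transparent_def accepts_Seq step_simps(5) by blast
  with Seq show ?case by simp
qed auto

text \<open>The negative premise of sequencing is essential: an accepting factor that can still move
  blocks all later ones. Hence \<open>q\<close> moves in \<open>Seq p q\<close> only if
  \<open>p\<close> is transparent and contributes no factor. An expression that is not a
  \<open>Seq\<close> and can move is its own sole factor.\<close>

lemma step_imp_factor_step:
  "tsp_step \<Delta> e a e' \<Longrightarrow>
    \<exists>p ps p'. factors \<Delta> e = p # ps \<and> tsp_step \<Delta> p a p' \<and> factors \<Delta> e' = factors \<Delta> p' @ ps"
proof (induction e arbitrary: e')
  case (Seq p q)
  from Seq.prems consider p' where "e' = Seq p' q" "tsp_step \<Delta> p a p'"
    | "transparent \<Delta> p" "tsp_step \<Delta> q a e'"
    unfolding step_simps(5) transparent_def by blast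
  then show ?case
  proof cases
    case 1
    obtain r ps r' where "factors \<Delta> p = r # ps" "tsp_step \<Delta> r a r'"
        "factors \<Delta> p' = factors \<Delta> r' @ ps"
      using Seq.IH(1)[OF 1(2)] by blast
    then show ?thesis using 1 by (intro exI[of _ r] exI[of _ "ps @ factors \<Delta> q"] exI[of _ r']) simp
  next
    case 2
    then show ?thesis using Seq.IH(2) factors_Nil_iff[of p] by simp
  qed
qed (auto simp: transparent_def)

lemma factor_step_imp_step:
  "factors \<Delta> e = p # ps \<Longrightarrow> tsp_step \<Delta> p a p' \<Longrightarrow>
    \<exists>e'. tsp_step \<Delta> e a e' \<and> factors \<Delta> e' = factors \<Delta> p' @ ps"
proof (induction e arbitrary: ps)
  case (Seq e1 e2)
  show ?case
  \<comment> \<open>An empty factor list makes \<open>e1\<close> transparent, which supplies both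
    premises that let \<open>e2\<close> move; otherwise the head factor belongs to
    \<open>e1\<close>.\<close>
  proof (cases "factors \<Delta> e1")
    case Nil
    with Seq.prems have "factors \<Delta> e2 = p # ps" by simp
    moreover have "transparent \<Delta> e1" using Nil factors_Nil_iff by simp
    ultimately show ?thesis
      using Seq.IH(2) Seq.prems(2) unfolding transparent_def step_simps(5) by blast
  next
    case (Cons q qs)
    with Seq.prems have "q = p" "ps = qs @ factors \<Delta> e2" by auto
    moreover from this obtain e' where "tsp_step \<Delta> e1 a e'" "factors \<Delta> e' = factors \<Delta> p' @ qs"
      using Seq.IH(1) Cons Seq.prems(2) by blast
    ultimately show ?thesis
      by (intro exI[of _ "Seq e' e2"]) (simp add: step_simps(5))
  qed
qed (auto split: if_splits)

text \<open>A target such as \<open>Seq p' q\<close> need not be a subexpression of any right-hand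
  side, but its factors are controlled: those of \<open>p'\<close> by induction and those of
  \<open>q\<close> directly. The alternative \<open>p = Ident X\<close> covers the first step from
  the root.\<close>

lemma factors_step_subset_spec_exprs:
  assumes "tsp_step \<Delta> p a p'" "subexprs p \<subseteq> spec_exprs \<Delta> \<or> p = Ident X"
  shows "set (factors \<Delta> p') \<subseteq> spec_exprs \<Delta>"
proof -
  \<comment> \<open>Stability of \<open>tsp_step\<close> provides an inductive derivation. Induction
    on derivations also passes through identifiers, where structural induction on \<open>p\<close>
    would give no hypothesis.\<close>
  have "step_wrt \<Delta> (\<lambda>p. \<nexists>a p'. tsp_step \<Delta> p a p') p a p'"
    using assms(1) tsp_step_stable[OF guarded] by metis
  then show ?thesis using assms(2)
  proof (induction rule: step_wrt.induct)
    case (step_Prefix a p)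
    then show ?case using factors_subset_subexprs[of \<Delta> p] by auto
  next
    case (step_Seq1 p a p' q)
    then show ?case using factors_subset_subexprs[of \<Delta> q] by auto
  next
    case (step_Ident Y p a p')
    then have "subexprs p \<subseteq> spec_exprs \<Delta>" by (auto simp: spec_exprs_def intro: ranI)
    with step_Ident show ?case by blast
  qed auto
qed

text \<open>Two structural inductions are used. The first treats guarded expressions, where the
  identifier case is vacuous; the second treats all expressions and resolves an identifier by
  applying the first to its right-hand side.\<close>

lemma finite_steps: "finite {(a, p'). tsp_step \<Delta> p a p'}"
proof -
  have Alt_steps: "{(a, r). tsp_step \<Delta> (Alt p q) a r} =
      {(a, r). tsp_step \<Delta> p a r} \<union> {(a, r). tsp_step \<Delta> q a r}" for p q
    by (auto simp: step_simps)
  have Seq_steps: "{(a, r). tsp_step \<Delta> (Seq p q) a r} \<subseteq>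
      (\<lambda>(a, p'). (a, Seq p' q)) ` {(a, r). tsp_step \<Delta> p a r} \<union> {(a, r). tsp_step \<Delta> q a r}" for p q
    by (auto simp: step_simps(5))
  have Prefix_steps: "{(a, r). tsp_step \<Delta> (Prefix b p) a r} = {(b, p)}" for b p
    by (auto simp: step_simps)
  have Const_steps: "{(a, r). tsp_step \<Delta> Zero a r} = {}" "{(a, r). tsp_step \<Delta> One a r} = {}"
    by (auto simp: step_simps)
  have g: "finite {(a, p'). tsp_step \<Delta> p a p'}" if "guarded_expr p" for p
    using that
  proof (induction p)
    case (Seq p q)
    then show ?case by (auto intro: finite_subset[OF Seq_steps])
  qed (simp_all add: Alt_steps Prefix_steps Const_steps)
  show ?thesis
  proof (induction p)
    case (Seq p q)
    then show ?case by (auto intro: finite_subset[OF Seq_steps])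
  next
    case (Ident Y)
    show ?case
    proof (cases "\<Delta> Y")
      case (Some p)
      with guarded have "guarded_expr p" unfolding guarded_spec_def by (auto intro: ranI)
      from g[OF this] show ?thesis using Some by (simp add: step_simps(6))
    qed (simp add: step_simps(6))
  qed (simp_all add: Alt_steps Prefix_steps Const_steps)
qed

section \<open>Finiteness and well-formedness of the automaton\<close>

lemma pushdown_automaton_seq_pda:
  assumes "finite Act" "finite (dom \<Delta>)" "rec_spec Act (dom \<Delta>) \<Delta>" "X \<in> dom \<Delta>"
  shows "pushdown_automaton (seq_pda Act \<Delta> f X)"
proof -
  have fin: "finite (spec_exprs \<Delta>)"
    using assms(2) by (simp add: spec_exprs_def finite_ran)
  let ?T = "\<lambda>p. {(a, p'). tsp_step \<Delta> p a p'}"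
  have expr: "p \<in> exprs Act (dom \<Delta>)" if "p \<in> spec_exprs \<Delta>" for p
  proof -
    have "q \<in> exprs Act (dom \<Delta>) \<Longrightarrow> p \<in> subexprs q \<Longrightarrow> p \<in> exprs Act (dom \<Delta>)" for q
      by (induction q) (auto simp: exprs_def)
    moreover have "One \<in> exprs Act (dom \<Delta>)" by (simp add: exprs_def)
    ultimately show ?thesis
      using that assms(3) unfolding spec_exprs_def rec_spec_def by blast
  qed
  have act: "a \<in> insert Tau (Vis ` Act)" if "p \<in> exprs Act (dom \<Delta>)" "tsp_step \<Delta> p a p'" for p a p'
    using process_graph_tsp_graph[OF assms(3) guarded that(1)] that
    unfolding process_graph_def tsp_graph_def by auto
  have X: "Ident X \<in> exprs Act (dom \<Delta>)" using assms(4) by (simp add: exprs_def)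
  have stack: "map f (annotate \<Delta> b ps) \<in> lists (f ` (spec_exprs \<Delta> \<times> UNIV))"
    if "set ps \<subseteq> spec_exprs \<Delta>" for b ps
    using that by (rule map_annotate_in_lists)
  have One: "One \<in> spec_exprs \<Delta>" by (simp add: spec_exprs_def)
  \<comment> \<open>Each kind of transition is the image of a tuple of parameters; finiteness then
    follows from that of the parameter sets.\<close>
  let ?step = "\<lambda>(s, p, b, a, p'). (s, a, Some (f (p, b)), map f (annotate \<Delta> b (factors \<Delta> p')),
    of_bool (b \<and> accepts \<Delta> p'))"
  let ?start = "\<lambda>(a, p'). (of_bool (accepts \<Delta> (Ident X)), a, None,
    map f (annotate \<Delta> True (factors \<Delta> p' @ [One])), of_bool (accepts \<Delta> p'))"
  have trans_cases [consumes 1, case_names step start]: thesis if "t \<in> pda_trans (seq_pda Act \<Delta> f X)"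
    and "\<And>s a p b p'. t = ?step (s, p, b, a, p') \<Longrightarrow> s \<in> {0, 1} \<Longrightarrow> p \<in> spec_exprs \<Delta> \<Longrightarrow>
      tsp_step \<Delta> p a p' \<Longrightarrow> thesis"
    and "\<And>a p'. t = ?start (a, p') \<Longrightarrow> tsp_step \<Delta> (Ident X) a p' \<Longrightarrow> thesis" for t thesis
    using that(1) by (auto simp: seq_pda_def intro: that(2,3))
  have "pda_trans (seq_pda Act \<Delta> f X) \<subseteq>
      ?step ` ({0, 1} \<times> (SIGMA p : spec_exprs \<Delta>. UNIV \<times> ?T p)) \<union> ?start ` ?T (Ident X)"
    by (rule subsetI, erule trans_cases) blast+
  moreover have "finite (?step ` ({0, 1} \<times> (SIGMA p : spec_exprs \<Delta>. UNIV \<times> ?T p)) \<union>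
      ?start ` ?T (Ident X))"
    using fin finite_steps by (intro finite_UnI finite_imageI finite_SigmaI finite_cartesian_product) auto
  ultimately have "finite (pda_trans (seq_pda Act \<Delta> f X))" by (rule finite_subset)
  moreover have "pda_trans (seq_pda Act \<Delta> f X) \<subseteq> {0, 1} \<times> insert Tau (Vis ` Act) \<times>
      insert None (Some ` f ` (spec_exprs \<Delta> \<times> UNIV)) \<times> lists (f ` (spec_exprs \<Delta> \<times> UNIV)) \<times> {0, 1}"
  proof (rule subsetI)
    fix t assume "t \<in> pda_trans (seq_pda Act \<Delta> f X)"
    then show "t \<in> {0, 1} \<times> insert Tau (Vis ` Act) \<times>
      insert None (Some ` f ` (spec_exprs \<Delta> \<times> UNIV)) \<times> lists (f ` (spec_exprs \<Delta> \<times> UNIV)) \<times> {0, 1}"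
    proof (cases rule: trans_cases)
      case (step s a p b p')
      moreover have "a \<in> insert Tau (Vis ` Act)" using act expr step by blast
      moreover have "set (factors \<Delta> p') \<subseteq> spec_exprs \<Delta>"
        using factors_step_subset_spec_exprs subexprs_subset_spec_exprs step by blast
      ultimately show ?thesis using stack[of "factors \<Delta> p'" b] by simp
    next
      case (start a p')
      moreover have "a \<in> insert Tau (Vis ` Act)" using act X start by blast
      moreover have "set (factors \<Delta> p' @ [One]) \<subseteq> spec_exprs \<Delta>"
        using factors_step_subset_spec_exprs[OF start(2), of X] One by simp
      ultimately show ?thesis using stack[of "factors \<Delta> p' @ [One]" True] by simp
    qed
  qed
  ultimately show ?thesis
    using assms(1) fin unfolding pushdown_automaton_def by (simp add: seq_pda_def)
qed

section \<open>The bisimulation between configurations and expressions\<close>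

lemma bisimilar_seq_pda:
  assumes "rec_spec Act P \<Delta>" "X \<in> P"
    and inj: "inj_on f (spec_exprs \<Delta> \<times> UNIV)"
  shows "bisimilar (pda_graph (seq_pda Act \<Delta> f X)) (tsp_graph Act P \<Delta> (Ident X))"
proof -
  \<comment> \<open>The configuration \<open>conf e\<close> represents \<open>e\<close>, and
    \<open>E\<close> collects the expressions whose factors are available as stack symbols. The pair
    of \<open>root\<close> and \<open>Ident X\<close> is added by hand because the automaton starts
    with an empty stack, without the marker.\<close>
  define conf where "conf e =
    (of_bool (accepts \<Delta> e) :: nat, map f (annotate \<Delta> True (factors \<Delta> e @ [One])))" for e
  define E where "E = {e \<in> exprs Act P. set (factors \<Delta> e) \<subseteq> spec_exprs \<Delta>}"
  define root where "root = (of_bool (accepts \<Delta> (Ident X)) :: nat, [] :: nat list)"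
  let ?M = "seq_pda Act \<Delta> f X"
  let ?G = "pda_graph ?M" and ?H = "tsp_graph Act P \<Delta> (Ident X)"
  let ?R = "insert (root, Ident X) ((\<lambda>e. (conf e, e)) ` E)"
  have One: "One \<in> spec_exprs \<Delta>" by (simp add: spec_exprs_def)
  have X: "Ident X \<in> exprs Act P" using assms(2) by (simp add: exprs_def)
  have conf_states: "conf e \<in> pg_states ?G" if "e \<in> E" for e
    using map_annotate_in_lists[of "factors \<Delta> e @ [One]" "spec_exprs \<Delta>" f \<Delta> True] that One
    by (simp add: conf_def E_def pda_graph_def seq_pda_def)
  have stack: "map f (annotate \<Delta> True ps) \<in> lists (pda_data ?M)" if "set ps \<subseteq> spec_exprs \<Delta>" for ps
    using map_annotate_in_lists[OF that] by (simp add: seq_pda_def)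
  have R_states: "c \<in> pg_states ?G \<and> e \<in> exprs Act P" if "(c, e) \<in> ?R" for c e
  proof -
    have "root \<in> pg_states ?G" by (simp add: root_def pda_graph_def seq_pda_def)
    with that conf_states X show ?thesis unfolding E_def by blast
  qed
  have step_exprs: "e' \<in> exprs Act P" if "e \<in> exprs Act P" "tsp_step \<Delta> e a e'" for e a e'
    using process_graph_tsp_graph[OF assms(1) guarded that(1)] that
    unfolding process_graph_def tsp_graph_def by auto
  have root_step: "e' \<in> E" if "tsp_step \<Delta> (Ident X) a e'" for a e'
    using step_exprs[OF X that] factors_step_subset_spec_exprs[OF that, of X] by (simp add: E_def)
  have conf_step: "(conf e, a, c) \<in> pg_trans ?G \<longleftrightarrow> (\<exists>p ps p'. factors \<Delta> e = p # ps \<and>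
      tsp_step \<Delta> p a p' \<and> c = (of_bool (accepts \<Delta> p' \<and> list_all (accepts \<Delta>) ps),
        map f (annotate \<Delta> True (factors \<Delta> p' @ ps @ [One]))))" if e: "e \<in> E" for e a c
  proof -
    \<comment> \<open>The top \<open>p\<close> may be the marker itself, namely when
      \<open>e\<close> has no factors.\<close>
    obtain p ps where ps: "factors \<Delta> e @ [One] = p # ps" by (cases "factors \<Delta> e") auto
    have sub: "p \<in> spec_exprs \<Delta>" "set ps \<subseteq> spec_exprs \<Delta>"
    proof -
      have "set (factors \<Delta> e @ [One]) \<subseteq> spec_exprs \<Delta>" using e One by (simp add: E_def)
      then show "p \<in> spec_exprs \<Delta>" "set ps \<subseteq> spec_exprs \<Delta>" unfolding ps by auto
    qed
    define b where "b = list_all (accepts \<Delta>) ps"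
    have conf: "conf e = (of_bool (accepts \<Delta> e), f (p, b) # map f (annotate \<Delta> True ps))"
      unfolding conf_def ps b_def by simp
    \<comment> \<open>Injectivity of \<open>f\<close> recovers the factor and its flag from the top
      symbol, so no transition for a different symbol applies.\<close>
    have f_eq: "f (p, b) = f (q, c) \<longleftrightarrow> p = q \<and> b = c" if "q \<in> spec_exprs \<Delta>" for q c
      using inj_on_eq_iff[OF inj, of "(p, b)" "(q, c)"] sub that by simp
    have top: "(of_bool B, a, Some (f (p, b)), x', s') \<in> pda_trans ?M \<longleftrightarrow> (\<exists>p'. tsp_step \<Delta> p a p' \<and>
        x' = map f (annotate \<Delta> b (factors \<Delta> p')) \<and> s' = of_bool (b \<and> accepts \<Delta> p'))"
      (is "?l \<longleftrightarrow> ?r") for B x' s'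
    proof
      assume ?l
      then obtain q c p' where q: "f (p, b) = f (q, c)" "q \<in> spec_exprs \<Delta>" and "tsp_step \<Delta> q a p'"
          "x' = map f (annotate \<Delta> c (factors \<Delta> p'))" "s' = of_bool (c \<and> accepts \<Delta> p')"
        unfolding seq_pda_def by auto
      moreover have "q = p" "c = b" using q f_eq by auto
      ultimately show ?r by blast
    next
      assume ?r
      then obtain p' where "tsp_step \<Delta> p a p'" "x' = map f (annotate \<Delta> b (factors \<Delta> p'))"
          "s' = of_bool (b \<and> accepts \<Delta> p')"
        by blast
      moreover have "of_bool B \<in> {0, 1 :: nat}" by simp
      ultimately show ?l using sub(1) unfolding seq_pda_def pda.simps by blast
    qed
    have "(conf e, a, c) \<in> pg_trans ?G \<longleftrightarrow> (\<exists>s' x'. (of_bool (accepts \<Delta> e), a, Some (f (p, b)), x', s')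
        \<in> pda_trans ?M \<and> c = (s', x' @ map f (annotate \<Delta> True ps)))"
      using stack[OF sub(2)] unfolding conf by (auto simp: pda_graph_def)
    also have "\<dots> \<longleftrightarrow> (\<exists>p'. tsp_step \<Delta> p a p' \<and> c = (of_bool (b \<and> accepts \<Delta> p'),
        map f (annotate \<Delta> b (factors \<Delta> p')) @ map f (annotate \<Delta> True ps)))"
      unfolding top by blast
    also have "\<dots> \<longleftrightarrow> (\<exists>p'. tsp_step \<Delta> p a p' \<and> c = (of_bool (accepts \<Delta> p' \<and> list_all (accepts \<Delta>) ps),
        map f (annotate \<Delta> True (factors \<Delta> p' @ ps))))"
      unfolding annotate_append b_def by (simp add: conj_commute)
    also have "\<dots> \<longleftrightarrow> (\<exists>p ps p'. factors \<Delta> e = p # ps \<and>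
      tsp_step \<Delta> p a p' \<and> c = (of_bool (accepts \<Delta> p' \<and> list_all (accepts \<Delta>) ps),
        map f (annotate \<Delta> True (factors \<Delta> p' @ ps @ [One]))))"
      \<comment> \<open>If \<open>factors \<Delta> e\<close> is empty, the top is
        \<open>One\<close>, which has no step, so both sides are false. Otherwise the marker is last
        in \<open>ps\<close>, and since it accepts it drops out of the acceptance condition.\<close>
      using ps by (cases "factors \<Delta> e") (auto simp: step_simps(2) acc_One)
    finally show ?thesis .
  qed
  \<comment> \<open>This identifies the successor computed by the automaton with the configuration
    of the target expression; the control states agree because acceptance can be read off the
    factors.\<close>
  have conf_eq: "conf e' = (of_bool (accepts \<Delta> p' \<and> list_all (accepts \<Delta>) ps),
      map f (annotate \<Delta> True (factors \<Delta> p' @ ps @ [One])))"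
    if "factors \<Delta> e' = factors \<Delta> p' @ ps" for e' p' ps
    using list_all_accepts_factors[of \<Delta> e'] list_all_accepts_factors[of \<Delta> p'] that
    by (simp add: conf_def)
  have E_step: "e' \<in> E" if "e \<in> E" "tsp_step \<Delta> e a e'" for e a e'
  proof -
    obtain p ps p' where p: "factors \<Delta> e = p # ps" "tsp_step \<Delta> p a p'"
        "factors \<Delta> e' = factors \<Delta> p' @ ps"
      using step_imp_factor_step[OF \<open>tsp_step \<Delta> e a e'\<close>] by blast
    have "set (factors \<Delta> p') \<subseteq> spec_exprs \<Delta>"
      using factors_step_subset_spec_exprs[OF p(2)] subexprs_subset_spec_exprs[of p \<Delta>] p(1) that(1)
      by (auto simp: E_def)
    then show ?thesis using that p step_exprs by (auto simp: E_def)
  qed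
  \<comment> \<open>The first move already installs the marker, so every later configuration has the
    form \<open>conf e'\<close>.\<close>
  have root_trans: "(root, a, c) \<in> pg_trans ?G \<longleftrightarrow> (\<exists>e'. tsp_step \<Delta> (Ident X) a e' \<and> c = conf e')" for a c
    unfolding root_def conf_def by (auto simp: pda_graph_def seq_pda_def)
  have H_trans: "(e, a, e') \<in> pg_trans ?H \<longleftrightarrow> e \<in> exprs Act P \<and> tsp_step \<Delta> e a e'" for e a e'
    by (simp add: tsp_graph_def)
  show ?thesis
  proof (rule bisimilarI[where R = ?R])
    show "(pg_root ?G, pg_root ?H) \<in> ?R"
      by (simp add: pda_graph_def tsp_graph_def seq_pda_def root_def)
    show "?R \<subseteq> pg_states ?G \<times> pg_states ?H"
    proof (rule subrelI)
      fix c e assume "(c, e) \<in> ?R"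
      from R_states[OF this] show "(c, e) \<in> pg_states ?G \<times> pg_states ?H"
        by (simp add: tsp_graph_def)
    qed
  next
    fix c e assume ce: "(c, e) \<in> ?R"
    then have "fst c = of_bool (accepts \<Delta> e)" by (auto simp: root_def conf_def)
    with R_states[OF ce] show "c \<in> pg_accept ?G \<longleftrightarrow> e \<in> pg_accept ?H"
      by (cases c) (simp add: pda_graph_def tsp_graph_def seq_pda_def)
  next
    fix c e a c' assume "(c, e) \<in> ?R" and step: "(c, a, c') \<in> pg_trans ?G"
    then consider "c = root" "e = Ident X" | "c = conf e" "e \<in> E" by blast
    then show "\<exists>e'. (e, a, e') \<in> pg_trans ?H \<and> (c', e') \<in> ?R"
    proof cases
      case 1
      with step obtain e' where "tsp_step \<Delta> (Ident X) a e'" "c' = conf e'"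
        using root_trans by blast
      then show ?thesis using 1 X root_step unfolding H_trans by blast
    next
      case 2
      with step obtain p ps p' where p: "factors \<Delta> e = p # ps" "tsp_step \<Delta> p a p'"
          "c' = (of_bool (accepts \<Delta> p' \<and> list_all (accepts \<Delta>) ps),
            map f (annotate \<Delta> True (factors \<Delta> p' @ ps @ [One])))"
        using conf_step by blast
      from factor_step_imp_step[OF p(1,2)] obtain e' where
        e': "tsp_step \<Delta> e a e'" "factors \<Delta> e' = factors \<Delta> p' @ ps" by blast
      moreover have "c' = conf e'" using conf_eq[OF e'(2)] p(3) by simp
      moreover have "e' \<in> E" using E_step 2 e' by blast
      ultimately show ?thesis using 2 unfolding H_trans E_def by blast
    qed
  next
    fix c e a e' assume "(c, e) \<in> ?R" and "(e, a, e') \<in> pg_trans ?H"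
    then consider "c = root" "e = Ident X" | "c = conf e" "e \<in> E" by blast
    moreover have step: "tsp_step \<Delta> e a e'" using \<open>(e, a, e') \<in> pg_trans ?H\<close> H_trans by blast
    ultimately show "\<exists>c'. (c, a, c') \<in> pg_trans ?G \<and> (c', e') \<in> ?R"
    proof cases
      case 1
      then show ?thesis using step root_step root_trans by blast
    next
      case 2
      have "(conf e, a, conf e') \<in> pg_trans ?G"
        using step_imp_factor_step[OF step] conf_eq unfolding conf_step[OF 2(2)] by blast
      moreover have "e' \<in> E" using E_step 2 step by blast
      ultimately show ?thesis using 2 by blast
    qed
  qed
qed

end

section \<open>Coding of the stack symbols and conclusion\<close>

theorem theorem6p9:
  fixes Act :: "'a set" and P :: "'x set"
    and \<Delta> :: "'x \<rightharpoonup> ('a, 'x) expr" and X :: 'x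
  assumes "finite Act" and "finite P"
    and "rec_spec Act P \<Delta>" and "guarded_spec \<Delta>"
    and "X \<in> P"
  shows "\<exists>M :: (nat, 'a, nat) pda.
    pushdown_automaton M \<and> pda_inputs M = Act \<and> card (pda_states M) \<le> 2 \<and>
    bisimilar (pda_graph M) (tsp_graph Act P \<Delta> (Ident X))"
proof -
  have P: "P = dom \<Delta>" using assms(3) by (simp add: rec_spec_def)
  \<comment> \<open>A finite domain gives finitely many right-hand sides, each with finitely many
    subexpressions; pairing with a flag keeps the set finite, so it embeds into
    \<open>nat\<close>.\<close>
  have "finite (spec_exprs \<Delta> \<times> (UNIV :: bool set))"
    using assms(2) P by (simp add: spec_exprs_def finite_ran)
  then obtain f :: "('a, 'x) expr \<times> bool \<Rightarrow> nat" where "inj_on f (spec_exprs \<Delta> \<times> UNIV)"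
    using finite_imp_inj_to_nat_seg by blast
  then have "bisimilar (pda_graph (seq_pda Act \<Delta> f X)) (tsp_graph Act P \<Delta> (Ident X))"
    by (rule bisimilar_seq_pda[OF assms(4,3,5)])
  moreover have "pushdown_automaton (seq_pda Act \<Delta> f X)"
    using pushdown_automaton_seq_pda[OF assms(4,1)] assms(2,3,5) unfolding P by blast
  moreover have "pda_inputs (seq_pda Act \<Delta> f X) = Act" "card (pda_states (seq_pda Act \<Delta> f X)) \<le> 2"
    by (simp_all add: seq_pda_def)
  ultimately show ?thesis by blast
qed

end
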